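(* Let $k \geq 2$ and $\ell \geq 1$ be integers, and let $\lambda=(\lambda_1\ge\lambda_2\ge\cdots\ge\lambda_k\ge 0)$ be a partition of $\ell$. Then the number of admissible sequences of $k-1$ lattice paths on the colored $\ell\times\ell$ square $Y$ of type $\lambda$ (that is, with $(t_0^0,t_1^0,\ldots,t_{k-1}^0)=\lambda$) is $(f^\lambda)^2$. Hence, denoting by $\mathcal{T}_\ell^k$ the set of all admissible sequences of $k-1$ lattice paths on $Y$, $$|\mathcal{T}_\ell^k| = \sum_{\lambda\vdash\ell,\ ht(\lambda)\le k}(f^\lambda)^2 .$$
   Context: Fix integers $\ell\ge 1$, $k\ge 2$. Colored square: $Y$ is the $\ell\times\ell$ square made of $\ell^2$ unit boxes with corners $(0,0),(\ell,0),(0,-\ell),(\ell,-\ell)$. The box whose upper left corner is $(a,b)$ (integers $0\le a\le \ell-1$, $-(\ell-1)\le b\le 0$) has color $a+b$. For $-(\ell-1)\le j\le \ell-1$ there are $\ell-|j|$ boxes of color $j$. Lattice paths: A lattice path on $Y$ is a path from $(0,-\ell)$ to $(\ell,0)$ consisting of unit moves up or right inside $Y$. For lattice paths $p,q$ write $p\le q$ if every box above $q$ is also above $p$. Numbers $t_i^j$: Given lattice paths $p_1\le p_2\le\cdots\le p_{k-1}$ on $Y$ and $-(\ell-1)\le j\le\ell-1$, let $t_i^j$ for $2\le i\le k-1$ be the number of $j$-colored boxes between $p_{i-1}$ and $p_i$, let $t_1^j$ be the number of $j$-colored boxes below $p_1$, and let $t_0^j$ be the number of $j$-colored boxes above $p_{k-1}$.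 Admissible: The sequence $p_1\le\cdots\le p_{k-1}$ is admissible if (1) $p_1$ does not cross the diagonal $y=x-\ell$, meaning that $p_1$ stays weakly below this line; and (2) for all $2\le i\le k-1$ and $-(\ell-1)\le j\le \ell-1$, $$t_i^j\le\min\Big\{t_{i-1}^j,\ \ell-|j|-t_1^j-\sum_{a=1}^{i-1}t_a^j\Big\},$$ and $t_i^j\le t_i^{j-1}$ if $j>0$, and $t_i^j\le t_i^{j+1}$ if $j<0$. For an admissible sequence, $(t_0^0,t_1^0,\ldots,t_{k-1}^0)$ is a partition of $\ell$ (trailing zeros allowed), called the type of the sequence. Tableaux: $f^\lambda$ is the number of standard Young tableaux of shape $\lambda$, and $ht(\lambda)$ is the number of nonzero parts (rows) of $\lambda$. *)

theory Defs
  imports Main "HOL-Library.FuncSet"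
begin

section \<open>Lattice paths on the colored square\<close>

type_synonym point = "int \<times> int"
type_synonym path = "point list"

text \<open>A unit box of \<open>Y\<close> is represented by its upper left corner \<open>(a, b)\<close>, so it occupies
  \<open>[a, a + 1] \<times> [b - 1, b]\<close>.\<close>

definition boxes :: "nat \<Rightarrow> point set" where
  "boxes l = {0..int l - 1} \<times> {- (int l - 1)..0}"

definition color :: "point \<Rightarrow> int" where
  "color c = fst c + snd c"

definition up_or_right :: "point \<Rightarrow> point \<Rightarrow> bool" where
  "up_or_right u v \<longleftrightarrow> v = (fst u, snd u + 1) \<or> v = (fst u + 1, snd u)"

text \<open>A path is the list of the lattice points it visits.\<close>

definition lattice_path :: "nat \<Rightarrow> path \<Rightarrow> bool" where
  "lattice_path l p \<longleftrightarrow>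
     p \<noteq> [] \<and> hd p = (0, - int l) \<and> last p = (int l, 0) \<and>
     successively up_or_right p \<and> set p \<subseteq> {0..int l} \<times> {- int l..0}"

text \<open>\<open>horizontal_step p a y\<close>: the move of \<open>p\<close> across column \<open>a\<close> takes place at height \<open>y\<close>.
  A box lies above (below) \<open>p\<close> if this move runs weakly below its lower edge (weakly above its
  upper edge).\<close>

definition horizontal_step :: "path \<Rightarrow> int \<Rightarrow> int \<Rightarrow> bool" where
  "horizontal_step p a y \<longleftrightarrow> (\<exists>i. Suc i < length p \<and> p ! i = (a, y) \<and> p ! Suc i = (a + 1, y))"

definition above :: "path \<Rightarrow> point \<Rightarrow> bool" where
  "above p c \<longleftrightarrow> (\<exists>y. horizontal_step p (fst c) y \<and> y \<le> snd c - 1)"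

definition below :: "path \<Rightarrow> point \<Rightarrow> bool" where
  "below p c \<longleftrightarrow> (\<exists>y. horizontal_step p (fst c) y \<and> snd c \<le> y)"

definition path_le :: "nat \<Rightarrow> path \<Rightarrow> path \<Rightarrow> bool" where
  "path_le l p q \<longleftrightarrow> (\<forall>c \<in> boxes l. above q c \<longrightarrow> above p c)"

text \<open>The sequence \<open>p\<^sub>1, \<dots>, p\<^sub>k\<^sub>-\<^sub>1\<close> is a list \<open>ps\<close> of length \<open>k - 1\<close>; because lists are indexed from
  \<open>0\<close>, \<open>p\<^sub>i\<close> is \<open>ps ! (i - 1)\<close>.\<close>

definition t_num :: "nat \<Rightarrow> path list \<Rightarrow> nat \<Rightarrow> int \<Rightarrow> nat" where
  "t_num l ps i j =
     (if i = 0 then card {c \<in> boxes l. color c = j \<and> above (last ps) c}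
      else if i = 1 then card {c \<in> boxes l. color c = j \<and> below (ps ! 0) c}
      else card {c \<in> boxes l. color c = j \<and> above (ps ! (i - 2)) c \<and> below (ps ! (i - 1)) c})"

text \<open>The inequalities are stated over the integers, since the second entry of the minimum may be
  negative.\<close>

definition admissible :: "nat \<Rightarrow> nat \<Rightarrow> path list \<Rightarrow> bool" where
  "admissible l k ps \<longleftrightarrow>
     length ps = k - 1 \<and> (\<forall>p \<in> set ps. lattice_path l p) \<and> sorted_wrt (path_le l) ps \<and>
     (\<forall>(x, y) \<in> set (ps ! 0). y \<le> x - int l) \<and>
     (\<forall>i \<in> {2..k - 1}. \<forall>j \<in> {- (int l - 1)..int l - 1}.
        int (t_num l ps i j) \<le>
          min (int (t_num l ps (i - 1) j))
              (int l - \<bar>j\<bar> - int (t_num l ps 1 j) - (\<Sum>a = 1..i - 1. int (t_num l ps a j))) \<and>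
        (j > 0 \<longrightarrow> t_num l ps i j \<le> t_num l ps i (j - 1)) \<and>
        (j < 0 \<longrightarrow> t_num l ps i j \<le> t_num l ps i (j + 1)))"

definition admissible_seqs :: "nat \<Rightarrow> nat \<Rightarrow> path list set" where
  "admissible_seqs l k = {ps. admissible l k ps}"

definition seq_type :: "nat \<Rightarrow> nat \<Rightarrow> path list \<Rightarrow> nat list" where
  "seq_type l k ps = map (\<lambda>i. t_num l ps i 0) [0..<k]"

section \<open>Partitions and standard Young tableaux\<close>

text \<open>Trailing zeros are allowed here, so a partition has many representations as a list; the one
  without zeros is unique.\<close>

definition is_partition :: "nat list \<Rightarrow> nat \<Rightarrow> bool" where
  "is_partition la n \<longleftrightarrow> sorted_wrt (\<ge>) la \<and> sum_list la = n"

definition ht :: "nat list \<Rightarrow> nat" where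
  "ht la = length (filter (\<lambda>x. x \<noteq> 0) la)"

definition young_diagram :: "nat list \<Rightarrow> (nat \<times> nat) set" where
  "young_diagram la = {(r, c). r < length la \<and> c < la ! r}"

definition standard_tableaux :: "nat list \<Rightarrow> (nat \<times> nat \<Rightarrow> nat) set" where
  "standard_tableaux la =
     {T \<in> extensional (young_diagram la).
        bij_betw T (young_diagram la) {1..sum_list la} \<and>
        (\<forall>r c c'. (r, c) \<in> young_diagram la \<and> (r, c') \<in> young_diagram la \<and> c < c' \<longrightarrow>
           T (r, c) < T (r, c')) \<and>
        (\<forall>r r' c. (r, c) \<in> young_diagram la \<and> (r', c) \<in> young_diagram la \<and> r < r' \<longrightarrow>
           T (r, c) < T (r', c))}"

definition num_SYT :: "nat list \<Rightarrow> nat" where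
  "num_SYT la = card (standard_tableaux la)"

end

theory Submission
  imports Defs
begin

text \<open>Cut the square along its colored diagonals. On the diagonal of color \<open>j\<close> the boxes between
  consecutive paths have counts \<open>t\<^sub>0\<^sup>j, \<dots>, t\<^sub>k\<^sub>-\<^sub>1\<^sup>j\<close> with sum \<open>l - \<bar>j\<bar>\<close>. For \<open>i = k - 1\<close> the second bound
  in the minimum reads \<open>t\<^sub>1\<^sup>j \<le> t\<^sub>0\<^sup>j\<close>, because the total is \<open>l - \<bar>j\<bar>\<close>; for \<open>k = 2\<close> this inequality is
  the diagonal condition on \<open>p\<^sub>1\<close>. Together with \<open>t\<^sub>i\<^sup>j \<le> t\<^sub>i\<^sub>-\<^sub>1\<^sup>j\<close> it says that every diagonal carries a
  partition of \<open>l - \<bar>j\<bar>\<close>. The remaining conditions say that \<open>t\<^sub>i\<^sup>j\<close> does not grow when \<open>j\<close> moves away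
  from \<open>0\<close>; for \<open>i \<le> 1\<close> this holds for any path, since a path takes unit steps. As the total drops by
  exactly one from each color to the next one outwards, the partitions lose one box at a time.

  So, read from color \<open>l\<close> down to \<open>0\<close> and from color \<open>-l\<close> up to \<open>0\<close>, an admissible sequence is a
  pair of chains of partitions that grow box by box from the empty partition to the type
  (\<open>bij_betw_box_counts\<close>, \<open>bij_betw_halves\<close>). Conversely any pair of chains with the same end comes
  from paths: consecutive columns of counts differ by a single box, so the partial sums that give
  the positions of the paths change by at most one, which is what a lattice path needs. A
  growing chain is a standard tableau that records when each box appears
  (\<open>bij_betw_tableau_chain\<close>), which yields the square of the number of tableaux. The total count
  follows by summing over all types, where trailing zeros do not affect tableaux.\<close>

section \<open>Lattice paths read along the diagonals\<close>

text \<open>A lattice path meets each line \<open>x + y = s\<close> with \<open>\<bar>s\<bar> \<le> l\<close> exactly once, so it is determined by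
  the \<open>x\<close>-coordinates of these points. The line \<open>x + y = j\<close> passes through the centers of the boxes
  of color \<open>j\<close>, so these coordinates directly give the box counts.\<close>

definition path_of :: "nat \<Rightarrow> (int \<Rightarrow> int) \<Rightarrow> path" where
  "path_of l x = map (\<lambda>s. (x s, s - x s)) [- int l..int l]"

definition track :: "nat \<Rightarrow> (int \<Rightarrow> int) \<Rightarrow> bool" where
  "track l x \<longleftrightarrow> x (- int l) = 0 \<and> x (int l) = int l \<and>
     (\<forall>s. - int l \<le> s \<and> s < int l \<longrightarrow> x (s + 1) = x s \<or> x (s + 1) = x s + 1)"

lemma track_increment:
  assumes "track l x" "- int l \<le> s" "s \<le> s'" "s' \<le> int l"
  shows "x s \<le> x s' \<and> x s' - x s \<le> s' - s"
  using assms(3,4)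
proof (induction s' rule: int_ge_induct)
  case base
  show ?case by simp
next
  case (step i)
  then have "x s \<le> x i \<and> x i - x s \<le> i - s" by simp
  moreover have "x (i + 1) = x i \<or> x (i + 1) = x i + 1"
    using assms(1,2) step unfolding track_def by auto
  ultimately show ?case by auto
qed

text \<open>Both bounds come from the endpoints: the coordinate rises by at most one per step, and it has
  to reach \<open>l\<close>.\<close>

lemma track_bounds:
  assumes "track l x" "\<bar>s\<bar> \<le> int l"
  shows "max 0 s \<le> x s" "x s \<le> int l + min 0 s"
proof -
  have "x (- int l) = 0" "x (int l) = int l"
    using assms(1) by (auto simp: track_def)
  then show "max 0 s \<le> x s" "x s \<le> int l + min 0 s"
    using track_increment[OF assms(1), of "- int l" s] track_increment[OF assms(1), of s "int l"] assms(2)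
    by (simp_all add: min_def max_def abs_le_iff)
qed

lemma length_path_of: "length (path_of l x) = 2 * l + 1"
  by (simp add: path_of_def)

lemma nth_path_of:
  assumes "i < 2 * l + 1"
  shows "path_of l x ! i = (x (int i - int l), int i - int l - x (int i - int l))"
proof -
  have "[- int l..int l] ! i = int i - int l" using assms by (subst nth_upto) auto
  then show ?thesis using assms by (simp add: path_of_def)
qed

lemma lattice_path_path_of:
  assumes "track l x"
  shows "lattice_path l (path_of l x)"
proof -
  have len: "length (path_of l x) = 2 * l + 1" by (rule length_path_of)
  then have ne: "path_of l x \<noteq> []" by auto
  have ends: "x (- int l) = 0" "x (int l) = int l"
    using assms by (auto simp: track_def)
  have "successively up_or_right (path_of l x)"
    unfolding successively_conv_nth
  proof (intro allI impI)
    fix i assume i: "Suc i < length (path_of l x)"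
    define s where "s = int i - int l"
    have s1: "int (Suc i) - int l = s + 1" by (simp add: s_def)
    have "x (s + 1) = x s \<or> x (s + 1) = x s + 1"
      using assms i len unfolding track_def s_def by auto
    then show "up_or_right (path_of l x ! i) (path_of l x ! Suc i)"
      using i len by (simp only: nth_path_of s1 flip: s_def) (auto simp: up_or_right_def nth_path_of s1 simp flip: s_def)
  qed
  moreover have "hd (path_of l x) = (0, - int l)"
    using ne ends by (simp add: hd_conv_nth nth_path_of)
  moreover have "last (path_of l x) = (int l, 0)"
    using ne ends len by (simp add: last_conv_nth nth_path_of)
  moreover have "set (path_of l x) \<subseteq> {0..int l} \<times> {- int l..0}"
  proof
    fix q assume "q \<in> set (path_of l x)"
    then obtain s where "- int l \<le> s" "s \<le> int l" "q = (x s, s - x s)"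
      unfolding path_of_def by auto
    then show "q \<in> {0..int l} \<times> {- int l..0}"
      using track_bounds[OF assms, of s] by (cases "0 \<le> s") auto
  qed
  ultimately show ?thesis using ne by (simp add: lattice_path_def)
qed

text \<open>The coordinate sum rises by one at each step, so the \<open>i\<close>-th point lies on the line
  \<open>x + y = i - l\<close>; the endpoint then fixes the length of the list.\<close>

lemma lattice_path_imp_track:
  assumes "lattice_path l p"
  obtains x where "track l x" "p = path_of l x"
proof -
  have ne: "p \<noteq> []" and hd: "hd p = (0, - int l)" and last: "last p = (int l, 0)"
    and suc: "successively up_or_right p"
    using assms by (auto simp: lattice_path_def)
  have step: "up_or_right (p ! i) (p ! Suc i)" if "Suc i < length p" for i
    using suc that by (simp add: successively_conv_nth)
  have diag: "fst (p ! i) + snd (p ! i) = int i - int l" if "i < length p" for i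
    using that
  proof (induction i)
    case 0
    then show ?case using ne hd by (simp add: hd_conv_nth)
  next
    case (Suc i)
    then show ?case using step[of i] by (auto simp: up_or_right_def)
  qed
  have len: "length p = 2 * l + 1"
    using diag[of "length p - 1"] last ne by (simp add: last_conv_nth) (simp add: of_nat_diff Suc_leI)
  define x where "x s = fst (p ! nat (s + int l))" for s
  have "track l x"
    unfolding track_def
  proof (intro conjI allI impI)
    show "x (- int l) = 0" using ne hd by (simp add: x_def hd_conv_nth)
    show "x (int l) = int l"
      using ne last len by (simp add: x_def last_conv_nth nat_mult_distrib)
    fix s assume s: "- int l \<le> s \<and> s < int l"
    have "nat (s + 1 + int l) = Suc (nat (s + int l))" using s by linarith
    moreover have "Suc (nat (s + int l)) < length p" using s len by linarith
    ultimately show "x (s + 1) = x s \<or> x (s + 1) = x s + 1"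
      using step[of "nat (s + int l)"] by (auto simp: x_def up_or_right_def)
  qed
  moreover have "p = path_of l x"
  proof (rule nth_equalityI)
    show "length p = length (path_of l x)" by (simp add: len length_path_of)
    fix i assume i: "i < length p"
    then show "p ! i = path_of l x ! i"
      using diag[OF i] len by (simp add: nth_path_of x_def prod_eq_iff)
  qed
  ultimately show ?thesis by (rule that)
qed

lemma horizontal_step_path_of:
  "horizontal_step (path_of l x) a y \<longleftrightarrow>
     - int l \<le> a + y \<and> a + y < int l \<and> x (a + y) = a \<and> x (a + y + 1) = a + 1"
proof
  assume "horizontal_step (path_of l x) a y"
  then obtain i where i: "Suc i < 2 * l + 1" "path_of l x ! i = (a, y)"
    "path_of l x ! Suc i = (a + 1, y)"
    by (auto simp: horizontal_step_def length_path_of)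
  define s where "s = int i - int l"
  have "int (Suc i) - int l = s + 1" by (simp add: s_def)
  then have "x s = a" "s - x s = y" "x (s + 1) = a + 1"
    using i by (auto simp only: nth_path_of s_def[symmetric] prod.inject Suc_lessD)
  moreover have "- int l \<le> s" "s < int l" using i by (auto simp: s_def)
  ultimately show "- int l \<le> a + y \<and> a + y < int l \<and> x (a + y) = a \<and> x (a + y + 1) = a + 1"
    by auto
next
  assume *: "- int l \<le> a + y \<and> a + y < int l \<and> x (a + y) = a \<and> x (a + y + 1) = a + 1"
  define i where "i = nat (a + y + int l)"
  have i: "int i - int l = a + y" "int (Suc i) - int l = a + y + 1" "Suc i < 2 * l + 1"
    using * by (auto simp: i_def)
  then have "path_of l x ! i = (a, y)" "path_of l x ! Suc i = (a + 1, y)"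
    using * by (simp_all only: nth_path_of Suc_lessD) auto
  with i show "horizontal_step (path_of l x) a y"
    by (auto simp: horizontal_step_def length_path_of)
qed

text \<open>The crossing happens at the last line on which the coordinate is still at most \<open>a\<close>.\<close>

lemma track_crosses_column:
  assumes "track l x" "0 \<le> a" "a < int l"
  obtains s where "- int l \<le> s" "s < int l" "x s = a" "x (s + 1) = a + 1"
proof -
  define S where "S = {s \<in> {- int l..int l}. x s \<le> a}"
  define m where "m = Max S"
  have "finite S" unfolding S_def by (rule finite_subset[of _ "{- int l..int l}"]) auto
  moreover have "- int l \<in> S" using assms by (simp add: S_def track_def)
  ultimately have m: "m \<in> S" "\<And>s. s \<in> S \<Longrightarrow> s \<le> m"
    unfolding m_def by (auto intro: Max_in)
  have "m \<noteq> int l" using m(1) assms by (auto simp: S_def track_def)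
  then have ml: "- int l \<le> m" "m < int l" using m(1) by (auto simp: S_def)
  have "m + 1 \<notin> S" using m(2)[of "m + 1"] by auto
  then have "a < x (m + 1)" using ml by (auto simp: S_def)
  moreover have "x m \<le> a" using m(1) by (simp add: S_def)
  moreover have "x (m + 1) = x m \<or> x (m + 1) = x m + 1"
    using assms(1) ml by (auto simp: track_def)
  ultimately show ?thesis using ml by (intro that[of m]) auto
qed

text \<open>A box is compared with a path along its own diagonal instead of its column: since the
  coordinate is monotone, the path crosses the column of the box after meeting the diagonal exactly
  if it meets the diagonal at or to the left of the upper left corner of the box.\<close>

lemma position_on_diagonal:
  assumes "track l x" "c \<in> boxes l"
  shows "below (path_of l x) c \<longleftrightarrow> x (color c) \<le> fst c"
    and "above (path_of l x) c \<longleftrightarrow> fst c < x (color c)"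
proof -
  obtain a b where c: "c = (a, b)" by (cases c)
  have a: "0 \<le> a" "a < int l" and ab: "\<bar>a + b\<bar> \<le> int l"
    using assms(2) by (auto simp: c boxes_def)
  from track_crosses_column[OF assms(1) a] obtain s where
    s: "- int l \<le> s" "s < int l" "x s = a" "x (s + 1) = a + 1" .
  note hs = horizontal_step_path_of[of l x a]
  have step_s: "horizontal_step (path_of l x) a (s - a)"
    using s by (simp add: hs)
  have lower: "x (a + b) \<le> a" if "a + b \<le> t" "x t = a" "t < int l" for t
    using track_increment[OF assms(1), of "a + b" t] that ab by auto
  have upper: "a < x (a + b)" if "t < a + b" "- int l \<le> t" "x (t + 1) = a + 1" for t
    using track_increment[OF assms(1), of "t + 1" "a + b"] that ab by (simp add: abs_le_iff)
  show "below (path_of l x) c \<longleftrightarrow> x (color c) \<le> fst c"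
  proof
    assume "below (path_of l x) c"
    then obtain y where "horizontal_step (path_of l x) a y" "b \<le> y"
      by (auto simp: below_def c)
    then show "x (color c) \<le> fst c"
      using lower[of "a + y"] by (auto simp: hs c color_def)
  next
    assume "x (color c) \<le> fst c"
    then have "a + b \<le> s" using upper[of s] s by (force simp: c color_def)
    then show "below (path_of l x) c"
      using step_s by (auto simp: below_def c intro!: exI[of _ "s - a"])
  qed
  show "above (path_of l x) c \<longleftrightarrow> fst c < x (color c)"
  proof
    assume "above (path_of l x) c"
    then obtain y where "horizontal_step (path_of l x) a y" "y \<le> b - 1"
      by (auto simp: above_def c)
    then show "fst c < x (color c)"
      using upper[of "a + y"] by (auto simp: hs c color_def)
  next
    assume "fst c < x (color c)"
    then have "s < a + b" using lower[of s] s by (force simp: c color_def)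
    then show "above (path_of l x) c"
      using step_s by (auto simp: above_def c intro!: exI[of _ "s - a"])
  qed
qed

lemma card_boxes_of_color:
  assumes "max 0 j \<le> u" "v \<le> int l + min 0 j"
  shows "card {c \<in> boxes l. color c = j \<and> u \<le> fst c \<and> fst c < v} = nat (v - u)"
proof -
  have "{c \<in> boxes l. color c = j \<and> u \<le> fst c \<and> fst c < v} = (\<lambda>a. (a, j - a)) ` {u..<v}"
    using assms by (auto simp: boxes_def color_def image_iff)
  moreover have "inj_on (\<lambda>a. (a, j - a)) {u..<v}" by (auto intro: inj_onI)
  ultimately show ?thesis by (simp add: card_image)
qed

lemma no_boxes_of_color:
  assumes "int l \<le> \<bar>color c\<bar>"
  shows "c \<notin> boxes l"
  using assms by (auto simp: boxes_def color_def)

lemma card_below_path_of: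
  assumes "track l x" "\<bar>j\<bar> \<le> int l"
  shows "card {c \<in> boxes l. color c = j \<and> below (path_of l x) c} = nat (int l + min 0 j - x j)"
proof -
  have "{c \<in> boxes l. color c = j \<and> below (path_of l x) c} =
        {c \<in> boxes l. color c = j \<and> x j \<le> fst c \<and> fst c < int l + min 0 j}"
    using position_on_diagonal(1)[OF assms(1)] by (auto simp: boxes_def color_def)
  then show ?thesis using card_boxes_of_color track_bounds[OF assms] by simp
qed

lemma card_above_path_of:
  assumes "track l x" "\<bar>j\<bar> \<le> int l"
  shows "card {c \<in> boxes l. color c = j \<and> above (path_of l x) c} = nat (x j - max 0 j)"
proof -
  have "{c \<in> boxes l. color c = j \<and> above (path_of l x) c} =
        {c \<in> boxes l. color c = j \<and> max 0 j \<le> fst c \<and> fst c < x j}"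
    using position_on_diagonal(2)[OF assms(1)] by (auto simp: boxes_def color_def)
  then show ?thesis
    using card_boxes_of_color[of j "max 0 j" "x j" l] track_bounds[OF assms] by (simp del: max.bounded_iff)
qed

lemma card_between_path_of:
  assumes "track l x" "track l x'" "\<bar>j\<bar> \<le> int l"
  shows "card {c \<in> boxes l. color c = j \<and> above (path_of l x) c \<and> below (path_of l x') c} =
         nat (x j - x' j)"
proof -
  have "{c \<in> boxes l. color c = j \<and> above (path_of l x) c \<and> below (path_of l x') c} =
        {c \<in> boxes l. color c = j \<and> x' j \<le> fst c \<and> fst c < x j}"
    using position_on_diagonal(2)[OF assms(1)] position_on_diagonal(1)[OF assms(2)] by auto
  then show ?thesis
    using card_boxes_of_color track_bounds[OF assms(1,3)] track_bounds[OF assms(2,3)] by simp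
qed

lemma path_le_path_of:
  assumes "track l x" "track l x'"
  shows "path_le l (path_of l x) (path_of l x') \<longleftrightarrow> (\<forall>j. \<bar>j\<bar> \<le> int l \<longrightarrow> x' j \<le> x j)"
proof
  assume le: "path_le l (path_of l x) (path_of l x')"
  show "\<forall>j. \<bar>j\<bar> \<le> int l \<longrightarrow> x' j \<le> x j"
  proof (intro allI impI, rule ccontr)
    fix j assume j: "\<bar>j\<bar> \<le> int l" and "\<not> x' j \<le> x j"
    then have lt: "x j < x' j" by simp
    define c where "c = (x j, j - x j)"
    have c: "c \<in> boxes l" "color c = j" "fst c = x j"
      using lt track_bounds[OF assms(1) j] track_bounds[OF assms(2) j]
      by (auto simp: boxes_def c_def color_def)
    then have "above (path_of l x') c" using lt by (simp add: position_on_diagonal assms)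
    then have "above (path_of l x) c" using le c by (simp add: path_le_def)
    then show False using c by (simp add: position_on_diagonal assms)
  qed
next
  assume *: "\<forall>j. \<bar>j\<bar> \<le> int l \<longrightarrow> x' j \<le> x j"
  have "above (path_of l x) c" if c: "c \<in> boxes l" "above (path_of l x') c" for c
  proof -
    have "\<bar>color c\<bar> \<le> int l" using no_boxes_of_color[of l c] c(1) by linarith
    then have "x' (color c) \<le> x (color c)" using * by simp
    then show ?thesis using c by (simp add: position_on_diagonal assms)
  qed
  then show "path_le l (path_of l x) (path_of l x')" by (auto simp: path_le_def)
qed

section \<open>Admissible sequences as arrays of box counts\<close>

definition paths_of :: "nat \<Rightarrow> nat \<Rightarrow> (nat \<Rightarrow> int \<Rightarrow> int) \<Rightarrow> path list" where
  "paths_of l k X = map (\<lambda>i. path_of l (X i)) [1..<k]"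

text \<open>The bottom boundary \<open>X 0\<close> of the square is added as an extra path, so that the boxes below
  \<open>p\<^sub>1\<close> are the boxes between two consecutive paths like all others.\<close>

definition nested_tracks :: "nat \<Rightarrow> nat \<Rightarrow> (nat \<Rightarrow> int \<Rightarrow> int) \<Rightarrow> bool" where
  "nested_tracks l k X \<longleftrightarrow> X 0 = (\<lambda>j. int l + min 0 j) \<and> (\<forall>i<k. track l (X i)) \<and>
     (\<forall>i j. Suc i < k \<and> \<bar>j\<bar> \<le> int l \<longrightarrow> X (Suc i) j \<le> X i j)"

definition box_counts :: "nat \<Rightarrow> nat \<Rightarrow> path list \<Rightarrow> nat \<Rightarrow> int \<Rightarrow> nat" where
  "box_counts l k ps i j = (if i < k then t_num l ps i j else 0)"

text \<open>Each column \<open>j\<close> is a partition of \<open>l - \<bar>j\<bar>\<close> with at most \<open>k\<close> parts, and the partitions shrink away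
  from column \<open>0\<close>. The truncated subtraction makes all columns outside the square empty, so
  \<open>j\<close> can range over all integers and arrays are equal as soon as they agree on the square.\<close>

definition shape_array :: "nat \<Rightarrow> nat \<Rightarrow> (nat \<Rightarrow> int \<Rightarrow> nat) \<Rightarrow> bool" where
  "shape_array l k \<tau> \<longleftrightarrow>
     (\<forall>i j. k \<le> i \<longrightarrow> \<tau> i j = 0) \<and>
     (\<forall>j. (\<Sum>i<k. \<tau> i j) = l - nat \<bar>j\<bar>) \<and>
     (\<forall>i j. \<tau> (Suc i) j \<le> \<tau> i j) \<and>
     (\<forall>i n. \<tau> i (int (Suc n)) \<le> \<tau> i (int n) \<and> \<tau> i (- int (Suc n)) \<le> \<tau> i (- int n))"

lemma shape_array_outside:
  assumes "shape_array l k \<tau>" "int l \<le> \<bar>j\<bar>"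
  shows "\<tau> i j = 0"
proof (cases "i < k")
  case True
  have "(\<Sum>i<k. \<tau> i j) = 0" using assms by (simp add: shape_array_def)
  then show ?thesis using True by simp
qed (use assms in \<open>simp add: shape_array_def\<close>)

lemma track_bottom: "track l (\<lambda>j. int l + min 0 j)"
  by (auto simp: track_def)

lemma box_counts_outside:
  assumes "int l \<le> \<bar>j\<bar>"
  shows "box_counts l k ps i j = 0"
proof -
  have none: "{c \<in> boxes l. color c = j \<and> P c} = {}" for P
    using no_boxes_of_color assms by blast
  show ?thesis by (simp add: box_counts_def t_num_def none)
qed

text \<open>Nestedness makes these differences nonnegative, so they hold over the integers.\<close>

lemma box_counts_paths_of:
  assumes "2 \<le> k" "nested_tracks l k X" "\<bar>j\<bar> \<le> int l"
  shows "int (box_counts l k (paths_of l k X) 0 j) = X (k - 1) j - max 0 j"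
    and "\<And>i. Suc i < k \<Longrightarrow> int (box_counts l k (paths_of l k X) (Suc i) j) = X i j - X (Suc i) j"
proof -
  have tr: "track l (X i)" if "i < k" for i
    using assms(2) that by (simp add: nested_tracks_def)
  have nth: "paths_of l k X ! i = path_of l (X (Suc i))" if "Suc i < k" for i
    proof -
    have "[1..<k] ! i = Suc i" using that by (subst nth_upt) auto
    then show ?thesis using that by (simp add: paths_of_def)
  qed
  have last: "last (paths_of l k X) = path_of l (X (k - 1))"
    using assms(1) by (simp add: paths_of_def last_map)
  show "int (box_counts l k (paths_of l k X) 0 j) = X (k - 1) j - max 0 j"
    using assms(1) tr[of "k - 1"] track_bounds(1)[OF tr assms(3), of "k - 1"]
    by (simp add: box_counts_def t_num_def last card_above_path_of assms(3) del: max.bounded_iff)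
  fix i assume i: "Suc i < k"
  show "int (box_counts l k (paths_of l k X) (Suc i) j) = X i j - X (Suc i) j"
  proof (cases i)
    case 0
    then show ?thesis
      using i assms(2) track_bounds(2)[OF tr assms(3), of 1]
      by (simp add: box_counts_def t_num_def nth tr card_below_path_of assms(3) nested_tracks_def)
  next
    case (Suc i')
    moreover have "X (Suc i) j \<le> X i j"
      using assms(2,3) i by (simp add: nested_tracks_def)
    ultimately show ?thesis
      using i by (simp add: box_counts_def t_num_def nth tr card_between_path_of assms(3))
  qed
qed

lemma box_counts_partial_sum:
  assumes "2 \<le> k" "nested_tracks l k X" "\<bar>j\<bar> \<le> int l" "i < k"
  shows "(\<Sum>a = 1..i. int (box_counts l k (paths_of l k X) a j)) = int l + min 0 j - X i j"
  using assms(4)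
proof (induction i)
  case 0
  then show ?case using assms(2) by (simp add: nested_tracks_def)
next
  case (Suc i)
  then show ?case using box_counts_paths_of(2)[OF assms(1-3), of i] by simp
qed

lemma sum_from_one:
  fixes f :: "nat \<Rightarrow> 'a::comm_monoid_add"
  assumes "0 < k"
  shows "(\<Sum>i<k. f i) = f 0 + (\<Sum>i = 1..k - 1. f i)"
proof -
  have "{..<k} = insert 0 {1..k - 1}" using assms by auto
  then show ?thesis by simp
qed

lemma box_counts_total:
  assumes "2 \<le> k" "nested_tracks l k X"
  shows "(\<Sum>i<k. box_counts l k (paths_of l k X) i j) = l - nat \<bar>j\<bar>"
proof (cases "\<bar>j\<bar> \<le> int l")
  case True
  have "(\<Sum>i<k. int (box_counts l k (paths_of l k X) i j)) = int l - \<bar>j\<bar>"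
    using assms(1) box_counts_paths_of(1)[OF assms True] box_counts_partial_sum[OF assms True, of "k - 1"]
    by (simp add: sum_from_one)
  then show ?thesis using True by (simp flip: of_nat_sum)
next
  case False
  then show ?thesis by (simp add: box_counts_outside)
qed

text \<open>Here the inequality between rows \<open>1\<close> and \<open>0\<close> is the point that needs an argument. The
  monotonicity of rows \<open>0\<close> and \<open>1\<close> away from color \<open>0\<close> is automatic, since these rows measure the
  distance of a single path from the boundary of the square.\<close>

lemma admissible_imp_shape_array:
  assumes k: "2 \<le> k" and X: "nested_tracks l k X" and adm: "admissible l k (paths_of l k X)"
  shows "shape_array l k (box_counts l k (paths_of l k X))"
proof -
  define \<tau> where "\<tau> = box_counts l k (paths_of l k X)"
  note first = box_counts_paths_of(1)[OF k X, folded \<tau>_def]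
  note diff = box_counts_paths_of(2)[OF k X, folded \<tau>_def]
  note psum = box_counts_partial_sum[OF k X, folded \<tau>_def]
  have out: "\<tau> i j = 0" if "int l \<le> \<bar>j\<bar>" for i j
    using that by (simp add: \<tau>_def box_counts_outside)
  have t: "t_num l (paths_of l k X) i j = \<tau> i j" if "i < k" for i j
    using that by (simp add: \<tau>_def box_counts_def)
  have tr: "track l (X i)" if "i < k" for i
    using X that by (simp add: nested_tracks_def)
  have X0: "X 0 j = int l + min 0 j" for j
    using X by (simp add: nested_tracks_def)
  have adm2: "int (\<tau> i j) \<le> int (\<tau> (i - 1) j) \<and>
      int (\<tau> i j) \<le> int l - \<bar>j\<bar> - int (\<tau> 1 j) - (\<Sum>a = 1..i - 1. int (\<tau> a j)) \<and>
      (j > 0 \<longrightarrow> \<tau> i j \<le> \<tau> i (j - 1)) \<and> (j < 0 \<longrightarrow> \<tau> i j \<le> \<tau> i (j + 1))"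
    if "2 \<le> i" "i < k" "\<bar>j\<bar> < int l" for i j
  proof -
    let ?t = "t_num l (paths_of l k X)"
    have "i \<in> {2..k - 1}" "j \<in> {- (int l - 1)..int l - 1}" using that by auto
    then have "int (?t i j) \<le> min (int (?t (i - 1) j))
          (int l - \<bar>j\<bar> - int (?t 1 j) - (\<Sum>a = 1..i - 1. int (?t a j))) \<and>
        (j > 0 \<longrightarrow> ?t i j \<le> ?t i (j - 1)) \<and> (j < 0 \<longrightarrow> ?t i j \<le> ?t i (j + 1))"
      using adm unfolding admissible_def by blast
    moreover have "(\<Sum>a = 1..i - 1. int (?t a j)) = (\<Sum>a = 1..i - 1. int (\<tau> a j))"
      using that by (intro sum.cong) (auto simp: t)
    ultimately show ?thesis
      using that t[of i] t[of "i - 1"] t[of 1] by simp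
  qed
  have antitone01: "\<tau> 1 j \<le> \<tau> 0 j" if j: "\<bar>j\<bar> < int l" for j
  proof (cases "k = 2")
    case True
    \<comment> \<open>The range of \<open>i\<close> is empty, and the diagonal condition compares the two sides of \<open>p\<^sub>1\<close>.\<close>
    have "(X 1 j, j - X 1 j) \<in> set (paths_of l k X ! 0)"
      using j True by (force simp: paths_of_def path_of_def)
    then have "j - X 1 j \<le> X 1 j - int l"
      using adm by (auto simp: admissible_def)
    then show ?thesis
      using first[of j] diff[of j 0] j True by (auto simp: X0)
  next
    case False
    \<comment> \<open>At \<open>i = k - 1\<close> the second bound plus the total is the wanted inequality.\<close>
    then obtain k' where k': "k = Suc (Suc (Suc k'))"
      using k by (metis Suc_le_D Suc_1 le_neq_implies_less less_natE numeral_2_eq_2 add_Suc)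
    have "int (\<tau> (k - 1) j) \<le> int l - \<bar>j\<bar> - int (\<tau> 1 j) - (\<Sum>a = 1..k - 1 - 1. int (\<tau> a j))"
      using adm2[of "k - 1" j] j k' by auto
    then show ?thesis
      using psum[of j "k - 1"] first[of j] j k' by auto
  qed
  have zero: "\<tau> i j = 0" if "k \<le> i" for i j
    using that by (simp add: \<tau>_def box_counts_def)
  have antitone: "\<tau> (Suc i) j \<le> \<tau> i j" for i j
  proof (cases "\<bar>j\<bar> < int l \<and> Suc i < k")
    case True
    then show ?thesis using adm2[of "Suc i" j] antitone01[of j] by (cases i) auto
  next
    case False
    then show ?thesis using out[of j "Suc i"] zero[of "Suc i" j] by (cases "Suc i < k") simp_all
  qed
  have right: "\<tau> i (int (Suc n)) \<le> \<tau> i (int n)" for i n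
  proof (cases "Suc n < l \<and> i < k")
    case True
    have step: "X i' (int n + 1) = X i' (int n) \<or> X i' (int n + 1) = X i' (int n) + 1" if "i' < k" for i'
      using tr[OF that] True by (simp add: track_def)
    consider "i = 0" | "i = 1" | "2 \<le> i" by linarith
    then show ?thesis
    proof cases
      case 1
      then show ?thesis
        using first[of "int n"] first[of "int n + 1"] True step[of "k - 1"] by (auto simp: add.commute)
    next
      case 2
      then show ?thesis
        using diff[of "int n" 0] diff[of "int n + 1" 0] True step[of 1] by (auto simp: X0 add.commute)
    next
      case 3
      then show ?thesis using adm2[of i "int (Suc n)"] True by auto
    qed
  next
    case False
    then show ?thesis
      using out[of "int (Suc n)" i] zero[of i "int (Suc n)"] by (cases "i < k") simp_all
  qed
  have left: "\<tau> i (- int (Suc n)) \<le> \<tau> i (- int n)" for i n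
  proof (cases "Suc n < l \<and> i < k")
    case True
    define s where "s = - int (Suc n)"
    have s1: "- int n = s + 1" and s: "- int l < s" "s < 0" using True by (auto simp: s_def)
    have step: "X i' (s + 1) = X i' s \<or> X i' (s + 1) = X i' s + 1" if "i' < k" for i'
      using tr[OF that] s by (simp add: track_def)
    consider "i = 0" | "i = 1" | "2 \<le> i" by linarith
    then have "\<tau> i s \<le> \<tau> i (s + 1)"
    proof cases
      case 1
      then show ?thesis
        using first[of s] first[of "s + 1"] s k step[of "k - 1"] by auto
    next
      case 2
      then show ?thesis
        using diff[of s 0] diff[of "s + 1" 0] s True step[of 1] by (auto simp: X0)
    next
      case 3
      then show ?thesis using adm2[of i s] s True by auto
    qed
    then show ?thesis by (simp only: s_def[symmetric] s1)
  next
    case False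
    then show ?thesis
      using out[of "- int (Suc n)" i] zero[of i "- int (Suc n)"] by (cases "i < k") simp_all
  qed
  show ?thesis
    using zero antitone left right box_counts_total[OF k X] unfolding shape_array_def \<tau>_def by blast
qed

text \<open>Row \<open>1\<close> being at most row \<open>0\<close> gives both the diagonal condition (the boxes above \<open>p\<^sub>1\<close> include
  those above the last path) and the second bound of the minimum: the rows \<open>0, \<dots>, i\<close> of a column
  sum to at most \<open>l - \<bar>j\<bar>\<close>.\<close>

lemma shape_array_imp_admissible:
  assumes k: "2 \<le> k" and X: "nested_tracks l k X"
    and arr: "shape_array l k (box_counts l k (paths_of l k X))"
  shows "admissible l k (paths_of l k X)"
proof -
  define \<tau> where "\<tau> = box_counts l k (paths_of l k X)"
  note first = box_counts_paths_of(1)[OF k X, folded \<tau>_def]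
  note diff = box_counts_paths_of(2)[OF k X, folded \<tau>_def]
  have t: "t_num l (paths_of l k X) i j = \<tau> i j" if "i < k" for i j
    using that by (simp add: \<tau>_def box_counts_def)
  have tr: "track l (X i)" if "i < k" for i
    using X that by (simp add: nested_tracks_def)
  have total: "(\<Sum>i<k. \<tau> i j) = l - nat \<bar>j\<bar>" and antitone: "\<tau> (Suc i) j \<le> \<tau> i j"
    and right: "\<tau> i (int (Suc n)) \<le> \<tau> i (int n)"
    and left: "\<tau> i (- int (Suc n)) \<le> \<tau> i (- int n)" for i j n
    using arr by (auto simp: shape_array_def \<tau>_def)
  have nested: "X i' j \<le> X i j" if "i \<le> i'" "i' < k" "\<bar>j\<bar> \<le> int l" for i i' j
    using that
  proof (induction i' rule: dec_induct)
    case (step n)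
    then have "X (Suc n) j \<le> X n j" using X by (simp add: nested_tracks_def)
    with step show ?case by simp
  qed simp
  have "sorted_wrt (path_le l) (paths_of l k X)"
    unfolding sorted_wrt_iff_nth_less
    by (auto simp: paths_of_def path_le_path_of tr intro!: nested)
  moreover have "\<forall>p \<in> set (paths_of l k X). lattice_path l p"
    by (auto simp: paths_of_def tr intro!: lattice_path_path_of)
  moreover have "y \<le> x - int l" if "(x, y) \<in> set (paths_of l k X ! 0)" for x y
  proof -
    have "(x, y) \<in> set (path_of l (X 1))" using that k by (simp add: paths_of_def)
    then obtain s where s: "\<bar>s\<bar> \<le> int l" "x = X 1 s" "y = s - X 1 s"
      by (force simp: path_of_def abs_le_iff)
    have "X 1 s - max 0 s \<ge> int l + min 0 s - X 1 s"
    proof -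
      have "X (k - 1) s \<le> X 1 s" using nested[of 1 "k - 1" s] s k by simp
      moreover have "int (\<tau> 1 s) = int l + min 0 s - X 1 s"
        using diff[of s 0] s k X by (simp add: nested_tracks_def)
      ultimately show ?thesis using antitone[of 0 s] first[of s] s by auto
    qed
    then show ?thesis using s by auto
  qed
  moreover have "int (t_num l (paths_of l k X) i j) \<le>
          min (int (t_num l (paths_of l k X) (i - 1) j))
              (int l - \<bar>j\<bar> - int (t_num l (paths_of l k X) 1 j)
                - (\<Sum>a = 1..i - 1. int (t_num l (paths_of l k X) a j))) \<and>
        (j > 0 \<longrightarrow> t_num l (paths_of l k X) i j \<le> t_num l (paths_of l k X) i (j - 1)) \<and>
        (j < 0 \<longrightarrow> t_num l (paths_of l k X) i j \<le> t_num l (paths_of l k X) i (j + 1))"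
    if i: "i \<in> {2..k - 1}" and j: "j \<in> {- (int l - 1)..int l - 1}" for i j
  proof -
    obtain i' where i': "i = Suc i'" "1 \<le> i'" "Suc i' < k" using i k by (cases i) auto
    have sum: "(\<Sum>a = 1..i'. int (t_num l (paths_of l k X) a j)) = (\<Sum>a = 1..i'. int (\<tau> a j))"
      using i' by (intro sum.cong) (auto simp: t)
    have "\<tau> 0 j + (\<Sum>a = 1..Suc i'. \<tau> a j) = (\<Sum>a<Suc (Suc i'). \<tau> a j)"
      by (subst sum_from_one) simp_all
    also have "\<dots> \<le> (\<Sum>a<k. \<tau> a j)" using i' by (intro sum_mono2) auto
    also have "\<dots> = l - nat \<bar>j\<bar>" by (rule total)
    finally have "\<tau> 0 j + (\<Sum>a = 1..i'. \<tau> a j) + \<tau> (Suc i') j \<le> l - nat \<bar>j\<bar>" by simp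
    then have "int (\<tau> 0 j) + (\<Sum>a = 1..i'. int (\<tau> a j)) + int (\<tau> (Suc i') j) \<le> int l - \<bar>j\<bar>"
      using j by (simp flip: of_nat_sum) linarith
    moreover have "\<tau> i j \<le> \<tau> i (j - 1)" if "j > 0"
      using right[of i "nat (j - 1)"] that by simp
    moreover have "\<tau> i j \<le> \<tau> i (j + 1)" if "j < 0"
      using left[of i "nat (- j - 1)"] that by (simp add: add.commute)
    ultimately show ?thesis
      using antitone[of 0 j] antitone[of i' j] i' k by (simp add: t sum)
  qed
  ultimately show ?thesis using k by (auto simp: admissible_def paths_of_def)
qed

lemma admissible_imp_nested_tracks:
  assumes k: "2 \<le> k" and adm: "admissible l k ps"
  obtains X where "nested_tracks l k X" "ps = paths_of l k X"
proof -
  have len: "length ps = k - 1" and lp: "\<forall>p \<in> set ps. lattice_path l p"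
    and sorted: "sorted_wrt (path_le l) ps"
    using adm by (auto simp: admissible_def)
  have "\<exists>x. track l x \<and> ps ! i = path_of l x" if "i < k - 1" for i
  proof -
    have "lattice_path l (ps ! i)" using that lp len by simp
    then show ?thesis by (metis lattice_path_imp_track)
  qed
  then obtain Z where Z: "\<And>i. i < k - 1 \<Longrightarrow> track l (Z i) \<and> ps ! i = path_of l (Z i)"
    by metis
  define X where "X i = (if i = 0 then (\<lambda>j. int l + min 0 j) else Z (i - 1))" for i
  have tr: "track l (X i)" if "i < k" for i
    using Z[of "i - 1"] that track_bottom by (auto simp: X_def)
  have "X (Suc i) j \<le> X i j" if "Suc i < k" "\<bar>j\<bar> \<le> int l" for i j
  proof (cases i)
    case 0
    then show ?thesis using track_bounds(2)[OF tr[OF that(1)] that(2)] by (simp add: X_def)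
  next
    case (Suc i')
    then have "path_le l (ps ! i') (ps ! Suc i')"
      using sorted that len by (simp add: sorted_wrt_iff_nth_less)
    then have "path_le l (path_of l (X i)) (path_of l (X (Suc i)))"
      using Z[of i'] Z[of "Suc i'"] Suc that by (simp add: X_def)
    then show ?thesis using path_le_path_of tr that by simp
  qed
  then have "nested_tracks l k X" using tr by (simp add: nested_tracks_def X_def)
  moreover have "ps = paths_of l k X"
    by (rule nth_equalityI) (use Z len in \<open>auto simp: paths_of_def X_def\<close>)
  ultimately show ?thesis by (rule that)
qed

text \<open>The paths are placed at the partial sums of the columns. Passing to a neighboring column
  moves one box in or out, hence changes each partial sum by at most one; so the positions move
  like those of a lattice path.\<close>

lemma shape_array_imp_nested_tracks:
  assumes k: "2 \<le> k" and arr: "shape_array l k \<tau>"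
  obtains X where "nested_tracks l k X" "box_counts l k (paths_of l k X) = \<tau>"
proof -
  define X where "X i j = int l + min 0 j - (\<Sum>a = 1..i. int (\<tau> a j))" for i j
  have zero: "\<tau> i j = 0" if "k \<le> i" for i j using arr that by (simp add: shape_array_def)
  have total: "(\<Sum>i<k. \<tau> i j) = l - nat \<bar>j\<bar>" 
    and right: "\<tau> i (int (Suc n)) \<le> \<tau> i (int n)"
    and left: "\<tau> i (- int (Suc n)) \<le> \<tau> i (- int n)" for i j n
    using arr by (auto simp: shape_array_def)
  note out = shape_array_outside[OF arr]
  have partial_step: "(\<Sum>a = 1..i. \<tau> a s) = (\<Sum>a = 1..i. \<tau> a s') \<or>
      (\<Sum>a = 1..i. \<tau> a s) = Suc (\<Sum>a = 1..i. \<tau> a s')"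
    if i: "i < k" and le: "\<And>a. \<tau> a s' \<le> \<tau> a s" and one: "l - nat \<bar>s\<bar> = Suc (l - nat \<bar>s'\<bar>)" for i s s'
  proof -
    have eq: "{..<k} = {1..i} \<union> ({..<k} - {1..i})" using i by auto
    have split: "(\<Sum>a<k. \<tau> a j) = (\<Sum>a = 1..i. \<tau> a j) + (\<Sum>a\<in>{..<k} - {1..i}. \<tau> a j)" for j
      by (subst eq, subst sum.union_disjoint) auto
    have "(\<Sum>a = 1..i. \<tau> a s') \<le> (\<Sum>a = 1..i. \<tau> a s)"
      "(\<Sum>a\<in>{..<k} - {1..i}. \<tau> a s') \<le> (\<Sum>a\<in>{..<k} - {1..i}. \<tau> a s)"
      by (intro sum_mono le)+
    then show ?thesis using split[of s] split[of s'] total[of s] total[of s'] one by linarith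
  qed
  have tr: "track l (X i)" if i: "i < k" for i
    unfolding track_def
  proof (intro conjI allI impI)
    show "X i (- int l) = 0" "X i (int l) = int l" by (simp_all add: X_def out)
    fix s assume s: "- int l \<le> s \<and> s < int l"
    show "X i (s + 1) = X i s \<or> X i (s + 1) = X i s + 1"
    proof (cases "0 \<le> s")
      case True
      have "\<tau> a (s + 1) \<le> \<tau> a s" for a using right[of a "nat s"] True by (simp add: add.commute)
      moreover have "l - nat \<bar>s\<bar> = Suc (l - nat \<bar>s + 1\<bar>)" using True s by linarith
      ultimately show ?thesis
        using partial_step[OF i, of "s + 1" s] True by (auto simp: X_def simp flip: of_nat_sum)
    next
      case False
      have "\<tau> a s \<le> \<tau> a (s + 1)" for a
        using left[of a "nat (- s - 1)"] False by (simp add: add.commute)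
      moreover have "l - nat \<bar>s + 1\<bar> = Suc (l - nat \<bar>s\<bar>)" using False s by linarith
      ultimately show ?thesis
        using partial_step[OF i, of s "s + 1"] False by (auto simp: X_def simp flip: of_nat_sum)
    qed
  qed
  have X: "nested_tracks l k X" using tr by (simp add: nested_tracks_def X_def fun_eq_iff)
  moreover have "box_counts l k (paths_of l k X) i j = \<tau> i j" for i j
  proof -
    consider "k \<le> i" | "int l \<le> \<bar>j\<bar>" | "\<bar>j\<bar> \<le> int l" "i = 0" | i' where "\<bar>j\<bar> \<le> int l" "i = Suc i'" "Suc i' < k"
    proof (cases i)
      case (Suc i')
      then show ?thesis using that(1,2) that(4)[of i'] by linarith
    qed (use that in linarith)
    then show ?thesis
    proof cases
      case 1
      then show ?thesis by (simp add: box_counts_def zero)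
    next
      case 2
      then show ?thesis by (simp add: box_counts_outside out)
    next
      case 3
      have "int (\<tau> 0 j) + (\<Sum>a = 1..k - 1. int (\<tau> a j)) = int l - \<bar>j\<bar>"
        using total[of j] 3 k by (subst (asm) sum_from_one) (auto simp flip: of_nat_sum)
      then show ?thesis using box_counts_paths_of(1)[OF k X 3(1)] 3 by (simp add: X_def)
    next
      case 4
      then show ?thesis using box_counts_paths_of(2)[OF k X 4(1,3)] by (simp add: X_def)
    qed
  qed
  ultimately show ?thesis using that by blast
qed

lemma paths_of_eqI:
  assumes k: "2 \<le> k" and X: "nested_tracks l k X" and X': "nested_tracks l k X'"
    and eq: "box_counts l k (paths_of l k X) = box_counts l k (paths_of l k X')"
  shows "paths_of l k X = paths_of l k X'"
proof -
  have "path_of l (X i) = path_of l (X' i)" if "i < k" for i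
  proof -
    have "X i j = X' i j" if "\<bar>j\<bar> \<le> int l" for j
      using box_counts_partial_sum[OF k X that \<open>i < k\<close>] box_counts_partial_sum[OF k X' that \<open>i < k\<close>]
      by (simp add: eq)
    then show ?thesis by (auto simp: path_of_def)
  qed
  then show ?thesis by (auto simp: paths_of_def)
qed

lemma bij_betw_box_counts:
  assumes k: "2 \<le> k"
  shows "bij_betw (box_counts l k) (admissible_seqs l k) {\<tau>. shape_array l k \<tau>}"
  unfolding bij_betw_def
proof
  show "inj_on (box_counts l k) (admissible_seqs l k)"
  proof (rule inj_onI)
    fix ps qs
    assume "ps \<in> admissible_seqs l k" "qs \<in> admissible_seqs l k"
      and eq: "box_counts l k ps = box_counts l k qs"
    then have "admissible l k ps" "admissible l k qs" by (auto simp: admissible_seqs_def)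
    then obtain X X' where "nested_tracks l k X" "ps = paths_of l k X"
      "nested_tracks l k X'" "qs = paths_of l k X'"
      using admissible_imp_nested_tracks[OF k] by metis
    then show "ps = qs" using paths_of_eqI[OF k] eq by simp
  qed
  show "box_counts l k ` admissible_seqs l k = {\<tau>. shape_array l k \<tau>}"
  proof (intro equalityI subsetI)
    fix \<tau> assume "\<tau> \<in> box_counts l k ` admissible_seqs l k"
    then obtain ps where "admissible l k ps" "\<tau> = box_counts l k ps"
      by (auto simp: admissible_seqs_def)
    then show "\<tau> \<in> {\<tau>. shape_array l k \<tau>}"
      using admissible_imp_nested_tracks[OF k] admissible_imp_shape_array[OF k] by (metis mem_Collect_eq)
  next
    fix \<tau> assume "\<tau> \<in> {\<tau>. shape_array l k \<tau>}"
    then have arr: "shape_array l k \<tau>" by simp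
    then obtain X where X: "nested_tracks l k X" "box_counts l k (paths_of l k X) = \<tau>"
      using shape_array_imp_nested_tracks[OF k] by metis
    then have "paths_of l k X \<in> admissible_seqs l k"
      using shape_array_imp_admissible[OF k] arr by (simp add: admissible_seqs_def)
    then show "\<tau> \<in> box_counts l k ` admissible_seqs l k" using X(2) by blast
  qed
qed

section \<open>Standard tableaux as growing chains of partitions\<close>

text \<open>\<open>\<nu> n\<close> is a partition of \<open>n\<close>, up to \<open>la\<close> at \<open>n = |la|\<close>; from there on the minimum keeps the chain
  constant, so that a chain is determined by its proper part.\<close>

definition growth_chain :: "nat list \<Rightarrow> (nat \<Rightarrow> nat \<Rightarrow> nat) \<Rightarrow> bool" where
  "growth_chain la \<nu> \<longleftrightarrow>
     (\<forall>n i. length la \<le> i \<longrightarrow> \<nu> n i = 0) \<and>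
     (\<forall>n. (\<Sum>i<length la. \<nu> n i) = min n (sum_list la)) \<and>
     (\<forall>n i. \<nu> n (Suc i) \<le> \<nu> n i) \<and>
     (\<forall>n i. \<nu> n i \<le> \<nu> (Suc n) i) \<and>
     (\<forall>i<length la. \<nu> (sum_list la) i = la ! i)"

definition tableau_chain :: "nat list \<Rightarrow> (nat \<times> nat \<Rightarrow> nat) \<Rightarrow> nat \<Rightarrow> nat \<Rightarrow> nat" where
  "tableau_chain la T n r = card {c. (r, c) \<in> young_diagram la \<and> T (r, c) \<le> n}"

definition chain_tableau :: "nat list \<Rightarrow> (nat \<Rightarrow> nat \<Rightarrow> nat) \<Rightarrow> nat \<times> nat \<Rightarrow> nat" where
  "chain_tableau la \<nu> = restrict (\<lambda>(r, c). LEAST n. c < \<nu> n r) (young_diagram la)"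

lemma young_diagram_Sigma: "young_diagram la = Sigma {..<length la} (\<lambda>r. {..<la ! r})"
  by (auto simp: young_diagram_def)

lemma finite_young_diagram: "finite (young_diagram la)"
  by (simp add: young_diagram_Sigma)

lemma card_young_diagram: "card (young_diagram la) = sum_list la"
  by (simp add: young_diagram_Sigma sum_list_sum_nth atLeast0LessThan)

lemma finite_row: "finite {c. (r, c) \<in> young_diagram la \<and> P c}"
  by (rule finite_subset[of _ "{..<la ! r}"]) (auto simp: young_diagram_def)

lemma down_closed_eq_lessThan_card:
  fixes A :: "nat set"
  assumes "finite A" "\<And>a b. a \<in> A \<Longrightarrow> b < a \<Longrightarrow> b \<in> A"
  shows "A = {..<card A}"
proof -
  obtain m where m: "m \<notin> A" "\<And>i. i < m \<Longrightarrow> i \<in> A"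
    using ex_new_if_finite[OF infinite_UNIV_nat assms(1)] exists_least_iff[of "\<lambda>m. m \<notin> A"] by blast
  have "A = {..<m}"
  proof (intro equalityI subsetI)
    fix a assume "a \<in> A"
    then show "a \<in> {..<m}" using assms(2)[of a m] m(1) by (cases a m rule: linorder_cases) auto
  qed (use m in auto)
  then show ?thesis by simp
qed

lemma standard_tableauxD:
  assumes "T \<in> standard_tableaux la"
  shows "T \<in> extensional (young_diagram la)"
    and "bij_betw T (young_diagram la) {1..sum_list la}"
    and "(r, c) \<in> young_diagram la \<Longrightarrow> (r, c') \<in> young_diagram la \<Longrightarrow> c < c' \<Longrightarrow> T (r, c) < T (r, c')"
    and "(r, c) \<in> young_diagram la \<Longrightarrow> (r', c) \<in> young_diagram la \<Longrightarrow> r < r' \<Longrightarrow> T (r, c) < T (r', c)"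
  using assms unfolding standard_tableaux_def by blast+

text \<open>The entries of a row increase, so those that are at most \<open>n\<close> form an initial segment of it. With
  the companion \<open>chain_tableau_le_iff\<close> this shows that tableau and chain determine each other.\<close>

lemma less_tableau_chain_iff:
  assumes T: "T \<in> standard_tableaux la" and rc: "(r, c) \<in> young_diagram la"
  shows "c < tableau_chain la T n r \<longleftrightarrow> T (r, c) \<le> n"
proof -
  define A where "A = {c. (r, c) \<in> young_diagram la \<and> T (r, c) \<le> n}"
  have "A = {..<card A}"
  proof (rule down_closed_eq_lessThan_card)
    show "finite A" unfolding A_def by (rule finite_row)
    fix a b assume ab: "a \<in> A" "b < a"
    then have "(r, b) \<in> young_diagram la" "(r, a) \<in> young_diagram la"
      by (auto simp: A_def young_diagram_def)
    then have "T (r, b) < T (r, a)" using standard_tableauxD(3)[OF T] ab(2) by blast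
    then show "b \<in> A" using ab \<open>(r, b) \<in> young_diagram la\<close> by (auto simp: A_def)
  qed
  moreover have "card A = tableau_chain la T n r" by (simp add: A_def tableau_chain_def)
  ultimately have "A = {..<tableau_chain la T n r}" by simp
  moreover have "c \<in> A \<longleftrightarrow> T (r, c) \<le> n" using rc by (simp add: A_def)
  ultimately show ?thesis by simp
qed

lemma growth_chain_tableau_chain:
  assumes la: "is_partition la l" and T: "T \<in> standard_tableaux la"
  shows "growth_chain la (tableau_chain la T)"
  unfolding growth_chain_def
proof (intro conjI allI impI)
  fix n i
  show "tableau_chain la T n i = 0" if "length la \<le> i"
    using that by (simp add: tableau_chain_def young_diagram_def)
  show "tableau_chain la T n (Suc i) \<le> tableau_chain la T n i"
    unfolding tableau_chain_def
  proof (rule card_mono[OF finite_row], intro subsetI CollectI conjI)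
    fix c assume "c \<in> {c. (Suc i, c) \<in> young_diagram la \<and> T (Suc i, c) \<le> n}"
    then have c: "(Suc i, c) \<in> young_diagram la" "T (Suc i, c) \<le> n" by simp_all
    then have "la ! Suc i \<le> la ! i"
      using la by (simp add: is_partition_def young_diagram_def sorted_wrt_iff_nth_less)
    then show c': "(i, c) \<in> young_diagram la"
      using c by (simp add: young_diagram_def)
    show "T (i, c) \<le> n" using standard_tableauxD(4)[OF T c' c(1)] c(2) by simp
  qed
  show "tableau_chain la T n i \<le> tableau_chain la T (Suc n) i"
    unfolding tableau_chain_def by (rule card_mono[OF finite_row]) auto
next
  fix n
  note bij = standard_tableauxD(2)[OF T]
  have "(\<Sum>i<length la. tableau_chain la T n i) =
        card (Sigma {..<length la} (\<lambda>r. {c. (r, c) \<in> young_diagram la \<and> T (r, c) \<le> n}))"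
    unfolding tableau_chain_def by (subst card_SigmaI) (auto intro: finite_row)
  also have "Sigma {..<length la} (\<lambda>r. {c. (r, c) \<in> young_diagram la \<and> T (r, c) \<le> n}) =
        {d \<in> young_diagram la. T d \<le> n}"
    by (auto simp: young_diagram_def)
  also have "card \<dots> = card {m \<in> {1..sum_list la}. m \<le> n}"
    by (rule bij_betw_same_card, rule bij_betw_Collect[OF bij]) simp
  also have "{m \<in> {1..sum_list la}. m \<le> n} = {1..min n (sum_list la)}" by auto
  finally show "(\<Sum>i<length la. tableau_chain la T n i) = min n (sum_list la)" by simp
next
  fix i assume i: "i < length la"
  have "T (i, c) \<le> sum_list la" if "c < la ! i" for c
  proof -
    have "(i, c) \<in> young_diagram la" using i that by (simp add: young_diagram_def)
    then have "T (i, c) \<in> {1..sum_list la}"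
      using bij_betwE[OF standard_tableauxD(2)[OF T]] by blast
    then show ?thesis by simp
  qed
  then have "{c. (i, c) \<in> young_diagram la \<and> T (i, c) \<le> sum_list la} = {..<la ! i}"
    using i by (auto simp: young_diagram_def)
  then show "tableau_chain la T (sum_list la) i = la ! i" by (simp add: tableau_chain_def)
qed

lemma growth_chain_mono:
  assumes "growth_chain la \<nu>" "m \<le> n"
  shows "\<nu> m i \<le> \<nu> n i"
proof (rule lift_Suc_mono_le[of "\<lambda>n. \<nu> n i"])
  show "\<nu> n i \<le> \<nu> (Suc n) i" for n using assms(1) by (simp add: growth_chain_def)
qed (rule assms(2))

text \<open>From there on the sum is constant while no part decreases.\<close>

lemma growth_chain_stationary:
  assumes "growth_chain la \<nu>" "sum_list la \<le> n"
  shows "\<nu> n i = \<nu> (sum_list la) i"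
proof (cases "i < length la")
  case True
  have "(\<Sum>i<length la. \<nu> m i) = min m (sum_list la)" for m
    using assms(1) by (simp add: growth_chain_def)
  from this[of n] this[of "sum_list la"]
  have eq: "(\<Sum>i<length la. \<nu> (sum_list la) i) = (\<Sum>i<length la. \<nu> n i)"
    using assms(2) by linarith
  show ?thesis
    using sum_mono_inv[OF eq growth_chain_mono[OF assms], of i] True by simp
next
  case False
  then show ?thesis using assms(1) by (simp add: growth_chain_def)
qed

lemma growth_chain_le:
  assumes "growth_chain la \<nu>" "i < length la"
  shows "\<nu> n i \<le> la ! i"
proof -
  have "\<nu> n i \<le> \<nu> (max n (sum_list la)) i" by (rule growth_chain_mono[OF assms(1)]) simp
  also have "\<dots> = \<nu> (sum_list la) i" by (rule growth_chain_stationary[OF assms(1)]) simp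
  finally show ?thesis using assms by (simp add: growth_chain_def)
qed

text \<open>The sums of \<open>\<nu> n\<close> and \<open>\<nu> (Suc n)\<close> differ by at most one while no part decreases.\<close>

lemma growth_chain_adds_one_box:
  assumes \<nu>: "growth_chain la \<nu>" and r: "\<nu> n r < \<nu> (Suc n) r"
  shows "\<nu> (Suc n) r = Suc (\<nu> n r)" and "r' \<noteq> r \<Longrightarrow> \<nu> (Suc n) r' = \<nu> n r'"
proof -
  let ?K = "{..<length la}"
  have rK: "r \<in> ?K" using \<nu> r by (auto simp: growth_chain_def simp flip: not_le)
  have total: "(\<Sum>i\<in>?K. \<nu> (Suc n) i) \<le> Suc (\<Sum>i\<in>?K. \<nu> n i)"
    using \<nu> by (simp add: growth_chain_def)
  have split: "(\<Sum>i\<in>?K. f i) = f r + (\<Sum>i\<in>?K - {r}. f i)" for f :: "nat \<Rightarrow> nat"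
    using rK by (simp add: sum.remove)
  have le: "\<nu> n i \<le> \<nu> (Suc n) i" for i using \<nu> by (simp add: growth_chain_def)
  have rest: "(\<Sum>i\<in>?K - {r}. \<nu> n i) \<le> (\<Sum>i\<in>?K - {r}. \<nu> (Suc n) i)"
    by (intro sum_mono le)
  show "\<nu> (Suc n) r = Suc (\<nu> n r)"
    using total rest r split[of "\<nu> n"] split[of "\<nu> (Suc n)"] by linarith
  assume "r' \<noteq> r"
  have eq: "(\<Sum>i\<in>?K - {r}. \<nu> n i) = (\<Sum>i\<in>?K - {r}. \<nu> (Suc n) i)"
    using total rest r split[of "\<nu> n"] split[of "\<nu> (Suc n)"] by linarith
  show "\<nu> (Suc n) r' = \<nu> n r'"
  proof (cases "r' \<in> ?K")
    case True
    then show ?thesis using sum_mono_inv[OF eq le, of r'] \<open>r' \<noteq> r\<close> by simp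
  next
    case False
    then show ?thesis using \<nu> by (simp add: growth_chain_def)
  qed
qed

lemma chain_tableau_le_iff:
  assumes \<nu>: "growth_chain la \<nu>" and rc: "(r, c) \<in> young_diagram la"
  shows "chain_tableau la \<nu> (r, c) \<le> n \<longleftrightarrow> c < \<nu> n r"
proof -
  have eq: "chain_tableau la \<nu> (r, c) = (LEAST n. c < \<nu> n r)"
    using rc by (simp add: chain_tableau_def)
  have "c < \<nu> (sum_list la) r" using \<nu> rc by (simp add: growth_chain_def young_diagram_def)
  then have "c < \<nu> (chain_tableau la \<nu> (r, c)) r" unfolding eq by (rule LeastI)
  then show ?thesis
    using growth_chain_mono[OF \<nu>, of "chain_tableau la \<nu> (r, c)" n r] unfolding eq
    by (auto intro: Least_le)
qed

text \<open>Every step adds a single box, so the time of appearance is injective, and there are as many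
  times as boxes. Boxes to the left and above appear no later because each \<open>\<nu> n\<close> is a partition;
  injectivity makes this strict.\<close>

lemma standard_chain_tableau:
  assumes \<nu>: "growth_chain la \<nu>"
  shows "chain_tableau la \<nu> \<in> standard_tableaux la"
proof -
  let ?T = "chain_tableau la \<nu>"
  let ?Y = "young_diagram la"
  have zero: "\<nu> 0 r = 0" for r
  proof (cases "r < length la")
    case True
    have "(\<Sum>i<length la. \<nu> 0 i) = 0" using \<nu> by (simp add: growth_chain_def)
    then show ?thesis using True by simp
  qed (use \<nu> in \<open>simp add: growth_chain_def\<close>)
  have pos: "\<exists>m. ?T (r, c) = Suc m \<and> \<nu> m r \<le> c \<and> c < \<nu> (Suc m) r" if rc: "(r, c) \<in> ?Y" for r c
  proof -
    note iff = chain_tableau_le_iff[OF \<nu> rc]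
    have "?T (r, c) \<noteq> 0" using iff[of 0] by (simp add: zero)
    then obtain m where "?T (r, c) = Suc m" by (cases "?T (r, c)") auto
    then show ?thesis using iff[of m] iff[of "Suc m"] by auto
  qed
  have inj: "inj_on ?T ?Y"
  proof (rule inj_onI)
    fix d d' assume d: "d \<in> ?Y" "d' \<in> ?Y" "?T d = ?T d'"
    obtain r c r' c' where [simp]: "d = (r, c)" "d' = (r', c')" by (cases d, cases d')
    obtain m where m: "\<nu> m r \<le> c" "c < \<nu> (Suc m) r" "\<nu> m r' \<le> c'" "c' < \<nu> (Suc m) r'"
      using pos[of r c] pos[of r' c'] d by auto
    then have "r = r'" using growth_chain_adds_one_box(2)[OF \<nu>, of m r r'] by force
    then show "d = d'" using growth_chain_adds_one_box(1)[OF \<nu>, of m r] m by simp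
  qed
  have "?T ` ?Y \<subseteq> {1..sum_list la}"
  proof
    fix n assume "n \<in> ?T ` ?Y"
    then obtain r c where rc: "(r, c) \<in> ?Y" "n = ?T (r, c)" by auto
    have "c < \<nu> (sum_list la) r" using \<nu> rc by (simp add: growth_chain_def young_diagram_def)
    then show "n \<in> {1..sum_list la}"
      using pos[OF rc(1)] chain_tableau_le_iff[OF \<nu> rc(1), of "sum_list la"] rc(2) by auto
  qed
  moreover have "card (?T ` ?Y) = card {1..sum_list la}"
    by (simp add: card_image[OF inj] card_young_diagram)
  ultimately have "bij_betw ?T ?Y {1..sum_list la}"
    using inj by (simp add: bij_betw_def card_subset_eq)
  moreover have less: "?T (r, c) < ?T (r', c')"
    if cells: "(r, c) \<in> ?Y" "(r', c') \<in> ?Y" "(r, c) \<noteq> (r', c')" and le: "\<And>n. c' < \<nu> n r' \<Longrightarrow> c < \<nu> n r"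
    for r c r' c'
  proof -
    have "?T (r, c) \<noteq> ?T (r', c')" using inj_onD[OF inj _ cells(1,2)] cells(3) by blast
    moreover have "?T (r, c) \<le> ?T (r', c')"
      using chain_tableau_le_iff[OF \<nu> cells(1)] chain_tableau_le_iff[OF \<nu> cells(2)] le by blast
    ultimately show ?thesis by simp
  qed
  have "?T (r, c) < ?T (r, c')" if "(r, c) \<in> ?Y" "(r, c') \<in> ?Y" "c < c'" for r c c'
    using that by (intro less) auto
  moreover have "?T (r, c) < ?T (r', c)" if "(r, c) \<in> ?Y" "(r', c) \<in> ?Y" "r < r'" for r r' c
  proof (rule less[OF that(1,2)])
    show "(r, c) \<noteq> (r', c)" using that(3) by simp
    fix n
    have "\<nu> n r' \<le> \<nu> n r"
    proof (rule lift_Suc_antimono_le[of "\<nu> n"])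
      show "\<nu> n (Suc i) \<le> \<nu> n i" for i using \<nu> by (simp add: growth_chain_def)
    qed (use that(3) in simp)
    then show "c < \<nu> n r'  \<Longrightarrow> c < \<nu> n r" by simp
  qed
  moreover have "?T \<in> extensional ?Y" by (simp add: chain_tableau_def)
  ultimately show ?thesis unfolding standard_tableaux_def by blast
qed

lemma bij_betw_tableau_chain:
  assumes "is_partition la l"
  shows "bij_betw (tableau_chain la) (standard_tableaux la) {\<nu>. growth_chain la \<nu>}"
proof (rule bij_betw_byWitness[where f' = "chain_tableau la"])
  show "\<forall>T\<in>standard_tableaux la. chain_tableau la (tableau_chain la T) = T"
  proof (intro ballI ext)
    fix T and d :: "nat \<times> nat" assume T: "T \<in> standard_tableaux la"
    obtain r c where d: "d = (r, c)" by (cases d)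
    show "chain_tableau la (tableau_chain la T) d = T d"
    proof (cases "d \<in> young_diagram la")
      case True
      then have rc: "(r, c) \<in> young_diagram la" using d by simp
      have "(LEAST n. c < tableau_chain la T n r) = (LEAST n. T (r, c) \<le> n)"
        by (simp only: less_tableau_chain_iff[OF T rc])
      also have "\<dots> = T (r, c)" by (rule Least_equality) simp_all
      finally show ?thesis using True d by (simp add: chain_tableau_def)
    next
      case False
      then have "T d = undefined" by (rule extensional_arb[OF standard_tableauxD(1)[OF T]])
      with False show ?thesis by (simp add: chain_tableau_def)
    qed
  qed
  show "\<forall>\<nu>\<in>{\<nu>. growth_chain la \<nu>}. tableau_chain la (chain_tableau la \<nu>) = \<nu>"
  proof (intro ballI ext)
    fix \<nu> n r assume "\<nu> \<in> {\<nu>. growth_chain la \<nu>}"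
    then have \<nu>: "growth_chain la \<nu>" by simp
    have "{c. (r, c) \<in> young_diagram la \<and> chain_tableau la \<nu> (r, c) \<le> n} =
          {c. (r, c) \<in> young_diagram la \<and> c < \<nu> n r}"
      using chain_tableau_le_iff[OF \<nu>] by blast
    also have "\<dots> = {..<\<nu> n r}"
    proof (cases "r < length la")
      case True
      then show ?thesis using growth_chain_le[OF \<nu> True, of n] by (auto simp: young_diagram_def)
    next
      case False
      then have "\<nu> n r = 0" using \<nu> by (simp add: growth_chain_def)
      then show ?thesis by simp
    qed
    finally show "tableau_chain la (chain_tableau la \<nu>) n r = \<nu> n r"
      by (simp add: tableau_chain_def)
  qed
  show "tableau_chain la ` standard_tableaux la \<subseteq> {\<nu>. growth_chain la \<nu>}"
    using growth_chain_tableau_chain[OF assms] by blast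
  show "chain_tableau la ` {\<nu>. growth_chain la \<nu>} \<subseteq> standard_tableaux la"
    using standard_chain_tableau by blast
qed

lemma card_growth_chains:
  assumes "is_partition la l"
  shows "card {\<nu>. growth_chain la \<nu>} = num_SYT la"
  using bij_betw_same_card[OF bij_betw_tableau_chain[OF assms]] by (simp add: num_SYT_def)

lemma finite_standard_tableaux: "finite (standard_tableaux la)"
proof (rule finite_subset)
  show "standard_tableaux la \<subseteq> young_diagram la \<rightarrow>\<^sub>E {1..sum_list la}"
  proof
    fix T assume "T \<in> standard_tableaux la"
    note T = standard_tableauxD(1,2)[OF this]
    then show "T \<in> young_diagram la \<rightarrow>\<^sub>E {1..sum_list la}"
      unfolding PiE_def using bij_betw_imp_funcset[OF T(2)] by blast
  qed
  show "finite (young_diagram la \<rightarrow>\<^sub>E {1..sum_list la})"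
    by (rule finite_PiE) (auto simp: finite_young_diagram)
qed

section \<open>Counting admissible sequences\<close>

text \<open>Chains run towards the middle of the square: step \<open>n\<close> is color \<open>l - n\<close> or \<open>n - l\<close>. By truncated
  subtraction all steps from \<open>l\<close> on show the middle column, in line with the convention that
  chains become constant.\<close>

definition right_half :: "nat \<Rightarrow> (nat \<Rightarrow> int \<Rightarrow> nat) \<Rightarrow> nat \<Rightarrow> nat \<Rightarrow> nat" where
  "right_half l \<tau> n i = \<tau> i (int (l - n))"

definition left_half :: "nat \<Rightarrow> (nat \<Rightarrow> int \<Rightarrow> nat) \<Rightarrow> nat \<Rightarrow> nat \<Rightarrow> nat" where
  "left_half l \<tau> n i = \<tau> i (- int (l - n))"

definition glue :: "nat \<Rightarrow> (nat \<Rightarrow> nat \<Rightarrow> nat) \<Rightarrow> (nat \<Rightarrow> nat \<Rightarrow> nat) \<Rightarrow> nat \<Rightarrow> int \<Rightarrow> nat" where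
  "glue l \<nu> \<mu> i j = (if 0 \<le> j then \<nu> (l - nat j) i else \<mu> (l - nat (- j)) i)"

lemma growth_chain_top:
  assumes "growth_chain la \<nu>"
  shows "\<nu> (sum_list la) i = (if i < length la then la ! i else 0)"
  using assms by (simp add: growth_chain_def)

lemma growth_chain_halves:
  assumes la: "sum_list la = l" "length la = k"
    and \<tau>: "shape_array l k \<tau>" "\<forall>i<k. \<tau> i 0 = la ! i"
  shows "growth_chain la (right_half l \<tau>)" and "growth_chain la (left_half l \<tau>)"
proof -
  have "right_half l \<tau> n i \<le> right_half l \<tau> (Suc n) i \<and> left_half l \<tau> n i \<le> left_half l \<tau> (Suc n) i"
    for n i
  proof (cases "n < l")
    case True
    then have "l - n = Suc (l - Suc n)" by simp
    then show ?thesis using \<tau>(1) by (simp only: shape_array_def right_half_def left_half_def)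
  next
    case False
    then show ?thesis by (simp add: right_half_def left_half_def)
  qed
  moreover have "(\<Sum>i<k. right_half l \<tau> n i) = min n l" "(\<Sum>i<k. left_half l \<tau> n i) = min n l" for n
    using \<tau>(1) by (simp_all add: shape_array_def right_half_def left_half_def)
  moreover have "right_half l \<tau> n (Suc i) \<le> right_half l \<tau> n i"
    "left_half l \<tau> n (Suc i) \<le> left_half l \<tau> n i" for n i
    using \<tau>(1) by (simp_all add: shape_array_def right_half_def left_half_def)
  moreover have "right_half l \<tau> n i = 0" "left_half l \<tau> n i = 0" if "k \<le> i" for n i
    using \<tau>(1) that by (simp_all add: shape_array_def right_half_def left_half_def)
  moreover have "right_half l \<tau> l i = la ! i" "left_half l \<tau> l i = la ! i" if "i < k" for i
    using \<tau>(2) that by (simp_all add: right_half_def left_half_def)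
  ultimately show "growth_chain la (right_half l \<tau>)" "growth_chain la (left_half l \<tau>)"
    unfolding growth_chain_def la by blast+
qed

lemma glue_halves:
  assumes "shape_array l k \<tau>"
  shows "glue l (right_half l \<tau>) (left_half l \<tau>) = \<tau>"
proof (intro ext)
  fix i j
  show "glue l (right_half l \<tau>) (left_half l \<tau>) i j = \<tau> i j"
  proof (cases "\<bar>j\<bar> \<le> int l")
    case True
    then have "0 \<le> j \<Longrightarrow> int (l - (l - nat j)) = j" "j < 0 \<Longrightarrow> - int (l - (l - nat (- j))) = j"
      by auto
    then show ?thesis by (simp add: glue_def right_half_def left_half_def)
  next
    case False
    moreover have "\<tau> i j = 0" "\<tau> i (int l) = 0" "\<tau> i (- int l) = 0"
      using False by (auto intro: shape_array_outside[OF assms])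
    ultimately show ?thesis by (simp add: glue_def right_half_def left_half_def)
  qed
qed

text \<open>Both chains end in \<open>la\<close>, so they agree in the middle column; otherwise the array could fail to
  shrink from column \<open>0\<close> to column \<open>-1\<close>.\<close>

lemma shape_array_glue:
  assumes la: "sum_list la = l" "length la = k"
    and \<nu>: "growth_chain la \<nu>" and \<mu>: "growth_chain la \<mu>"
  shows "shape_array l k (glue l \<nu> \<mu>)" and "i < k \<Longrightarrow> glue l \<nu> \<mu> i 0 = la ! i"
    and "right_half l (glue l \<nu> \<mu>) = \<nu>" and "left_half l (glue l \<nu> \<mu>) = \<mu>"
proof -
  have top: "\<nu> l i = (if i < k then la ! i else 0)" "\<mu> l i = (if i < k then la ! i else 0)" for i
    using growth_chain_top[OF \<nu>] growth_chain_top[OF \<mu>] la by simp_all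
  have right: "glue l \<nu> \<mu> i (int n) = \<nu> (l - n) i" for i n by (simp add: glue_def)
  have left: "glue l \<nu> \<mu> i (- int n) = \<mu> (l - n) i" for i n
    by (cases "n = 0") (simp_all add: glue_def top)
  have sum: "(\<Sum>i<k. \<nu> n i) = min n l" "(\<Sum>i<k. \<mu> n i) = min n l" for n
    using \<nu> \<mu> la unfolding growth_chain_def by blast+
  show "shape_array l k (glue l \<nu> \<mu>)"
    unfolding shape_array_def
  proof (intro conjI allI impI)
    fix i n j
    show "glue l \<nu> \<mu> i j = 0" if "k \<le> i"
      using \<nu> \<mu> la that by (simp add: glue_def growth_chain_def)
    show "(\<Sum>i<k. glue l \<nu> \<mu> i j) = l - nat \<bar>j\<bar>"
      by (cases "0 \<le> j") (simp_all add: glue_def sum)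
    show "glue l \<nu> \<mu> (Suc i) j \<le> glue l \<nu> \<mu> i j"
      using \<nu> \<mu> by (simp add: glue_def growth_chain_def)
    show "glue l \<nu> \<mu> i (int (Suc n)) \<le> glue l \<nu> \<mu> i (int n)"
      unfolding right by (rule growth_chain_mono[OF \<nu>]) simp
    show "glue l \<nu> \<mu> i (- int (Suc n)) \<le> glue l \<nu> \<mu> i (- int n)"
      unfolding left by (rule growth_chain_mono[OF \<mu>]) simp
  qed
  show "glue l \<nu> \<mu> i 0 = la ! i" if "i < k" for i
    using that by (simp add: glue_def top)
  have stat: "\<xi> (l - (l - n)) i = \<xi> n i" if "growth_chain la \<xi>" for \<xi> n i
  proof (cases "n \<le> l")
    case False
    then show ?thesis using growth_chain_stationary[OF that, of n i] la(1) by simp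
  qed simp
  show "right_half l (glue l \<nu> \<mu>) = \<nu>"
    by (intro ext) (simp only: right_half_def right stat[OF \<nu>])
  show "left_half l (glue l \<nu> \<mu>) = \<mu>"
    by (intro ext) (simp only: left_half_def left stat[OF \<mu>])
qed

lemma bij_betw_halves:
  assumes la: "sum_list la = l" "length la = k"
  shows "bij_betw (\<lambda>\<tau>. (right_half l \<tau>, left_half l \<tau>))
     {\<tau>. shape_array l k \<tau> \<and> (\<forall>i<k. \<tau> i 0 = la ! i)}
     ({\<nu>. growth_chain la \<nu>} \<times> {\<nu>. growth_chain la \<nu>})"
proof (rule bij_betw_byWitness[where f' = "\<lambda>(\<nu>, \<mu>). glue l \<nu> \<mu>"], goal_cases)
  case 1
  show ?case by (auto intro: glue_halves)
next
  case 2
  show ?case using shape_array_glue(3,4)[OF la] by fast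
next
  case 3
  show ?case using growth_chain_halves[OF la] by blast
next
  case 4
  show ?case using shape_array_glue(1,2)[OF la] by fast
qed

lemma seq_type_eq_iff:
  assumes "length la = k"
  shows "seq_type l k ps = la \<longleftrightarrow> (\<forall>i<k. box_counts l k ps i 0 = la ! i)"
  using assms by (auto simp: seq_type_def box_counts_def list_eq_iff_nth_eq)

lemma bij_betw_admissible_of_type:
  assumes "2 \<le> k" "length la = k"
  shows "bij_betw (box_counts l k) {ps \<in> admissible_seqs l k. seq_type l k ps = la}
     {\<tau>. shape_array l k \<tau> \<and> (\<forall>i<k. \<tau> i 0 = la ! i)}"
proof -
  have "bij_betw (box_counts l k) {ps \<in> admissible_seqs l k. seq_type l k ps = la}
      {\<tau> \<in> {\<tau>. shape_array l k \<tau>}. \<forall>i<k. \<tau> i 0 = la ! i}"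
    by (rule bij_betw_Collect[OF bij_betw_box_counts[OF assms(1)]]) (simp add: seq_type_eq_iff[OF assms(2)])
  then show ?thesis by simp
qed

lemma card_admissible_of_type:
  assumes "2 \<le> k" "is_partition la l" "length la = k"
  shows "finite {ps \<in> admissible_seqs l k. seq_type l k ps = la}"
    and "card {ps \<in> admissible_seqs l k. seq_type l k ps = la} = (num_SYT la)\<^sup>2"
proof -
  have "sum_list la = l" using assms(2) by (simp add: is_partition_def)
  note bij = bij_betw_trans[OF bij_betw_admissible_of_type[OF assms(1,3)] bij_betw_halves[OF this assms(3)]]
  have "finite {\<nu>. growth_chain la \<nu>}"
    using bij_betw_finite[OF bij_betw_tableau_chain[OF assms(2)]] finite_standard_tableaux by simp
  then show "finite {ps \<in> admissible_seqs l k. seq_type l k ps = la}"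
    using bij_betw_finite[OF bij] by simp
  show "card {ps \<in> admissible_seqs l k. seq_type l k ps = la} = (num_SYT la)\<^sup>2"
    using bij_betw_same_card[OF bij] card_growth_chains[OF assms(2)]
    by (simp add: card_cartesian_product power2_eq_square)
qed

text \<open>The type is the middle column of the shape array.\<close>

lemma seq_type_is_partition:
  assumes "2 \<le> k" "ps \<in> admissible_seqs l k"
  shows "is_partition (seq_type l k ps) l" and "length (seq_type l k ps) = k"
proof -
  define \<tau> where "\<tau> = box_counts l k ps"
  have \<tau>: "shape_array l k \<tau>"
    using bij_betwE[OF bij_betw_box_counts[OF assms(1)]] assms(2) by (simp add: \<tau>_def)
  show len: "length (seq_type l k ps) = k" by (simp add: seq_type_def)
  have nth: "seq_type l k ps ! i = \<tau> i 0" if "i < k" for i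
    using that by (simp add: seq_type_def \<tau>_def box_counts_def)
  have "\<tau> i' 0 \<le> \<tau> i 0" if "i \<le> i'" for i i'
  proof (rule lift_Suc_antimono_le[of "\<lambda>i. \<tau> i 0"])
    show "\<tau> (Suc i) 0 \<le> \<tau> i 0" for i using \<tau> by (simp add: shape_array_def)
  qed (rule that)
  then have "sorted_wrt (\<ge>) (seq_type l k ps)"
    by (simp add: sorted_wrt_iff_nth_less len nth)
  moreover have "sum_list (seq_type l k ps) = (\<Sum>i<k. \<tau> i 0)"
    by (simp add: sum_list_sum_nth len nth atLeast0LessThan)
  moreover have "(\<Sum>i<k. \<tau> i 0) = l" using \<tau> by (simp add: shape_array_def)
  ultimately show "is_partition (seq_type l k ps) l" by (simp add: is_partition_def)
qed

lemma finite_partitions_of_length: "finite {la. is_partition la l \<and> length la = k}"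
proof (rule finite_subset)
  show "{la. is_partition la l \<and> length la = k} \<subseteq> {la. set la \<subseteq> {..l} \<and> length la = k}"
    by (auto simp: is_partition_def member_le_sum_list)
  show "finite {la. set la \<subseteq> {..l} \<and> length la = k}"
    by (rule finite_lists_length_eq) simp
qed

lemma partition_strip_zeros:
  assumes "sorted_wrt (\<ge>) (la :: nat list)"
  shows "filter (\<lambda>x. x \<noteq> 0) la @ replicate (length la - ht la) 0 = la"
  using assms
proof (induction la)
  case (Cons x la)
  show ?case
  proof (cases "x = 0")
    case True
    then have "\<forall>y\<in>set la. y = 0" using Cons.prems by simp
    then have "filter (\<lambda>x. x \<noteq> 0) la = []" "la = replicate (length la) 0"
      by (auto simp: filter_empty_conv replicate_length_same)
    then show ?thesis using True by (simp add: ht_def)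
  next
    case False
    then show ?thesis using Cons by (simp add: ht_def)
  qed
qed simp

lemma num_SYT_append_zeros: "num_SYT (la @ replicate m 0) = num_SYT la"
proof -
  have "(r, c) \<in> young_diagram (la @ replicate m 0) \<longleftrightarrow> (r, c) \<in> young_diagram la" for r c
    by (cases "r < length la"; cases "r < length la + m") (simp_all add: young_diagram_def nth_append)
  then have "young_diagram (la @ replicate m 0) = young_diagram la"
    by (simp add: set_eq_iff split_paired_all)
  then show ?thesis by (simp add: num_SYT_def standard_tableaux_def sum_list_replicate)
qed

text \<open>Padding with zeros to length \<open>k\<close> identifies the partitions of height at most \<open>k\<close> with the types,
  and it does not change the Young diagram.\<close>

lemma sum_num_SYT_without_zeros:
  "(\<Sum>la | is_partition la l \<and> length la = k. (num_SYT la)\<^sup>2) =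
   (\<Sum>la | is_partition la l \<and> 0 \<notin> set la \<and> ht la \<le> k. (num_SYT la)\<^sup>2)"
proof (rule sum.reindex_bij_witness[where i = "\<lambda>la. la @ replicate (k - length la) 0"
      and j = "filter (\<lambda>x. x \<noteq> 0)"])
  have no_zero: "filter (\<lambda>x. x \<noteq> 0) la = la" "ht la = length la" if "0 \<notin> set la" for la :: "nat list"
  proof -
    show "filter (\<lambda>x. x \<noteq> 0) la = la" using that by (intro filter_True) metis
    then show "ht la = length la" by (simp only: ht_def)
  qed
  fix la
  { assume la: "la \<in> {la. is_partition la l \<and> length la = k}"
    then have "sorted_wrt (\<ge>) la" by (simp add: is_partition_def)
    note strip = partition_strip_zeros[OF this]
    have len: "length (filter (\<lambda>x. x \<noteq> 0) la) = ht la" by (simp add: ht_def)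
    show "filter (\<lambda>x. x \<noteq> 0) la @ replicate (k - length (filter (\<lambda>x. x \<noteq> 0) la)) 0 = la"
      unfolding len using strip la by simp
    have "sum_list (filter (\<lambda>x. x \<noteq> 0) la) = sum_list la"
      by (subst (2) strip[symmetric]) (simp add: sum_list_replicate)
    moreover have "ht (filter (\<lambda>x. x \<noteq> 0) la) \<le> length la" by (simp add: ht_def)
    ultimately show "filter (\<lambda>x. x \<noteq> 0) la \<in> {la. is_partition la l \<and> 0 \<notin> set la \<and> ht la \<le> k}"
      using la by (auto simp: is_partition_def sorted_wrt_filter)
    show "(num_SYT (filter (\<lambda>x. x \<noteq> 0) la))\<^sup>2 = (num_SYT la)\<^sup>2"
      using num_SYT_append_zeros[of "filter (\<lambda>x. x \<noteq> 0) la" "length la - ht la"] by (simp only: strip) }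
  { assume la: "la \<in> {la. is_partition la l \<and> 0 \<notin> set la \<and> ht la \<le> k}"
    then show "filter (\<lambda>x. x \<noteq> 0) (la @ replicate (k - length la) 0) = la"
      using no_zero(1)[of la] by simp
    show "la @ replicate (k - length la) 0 \<in> {la. is_partition la l \<and> length la = k}"
    proof -
      have "sorted_wrt (\<ge>) (replicate (k - length la) (0 :: nat))"
        by (simp add: sorted_wrt_iff_nth_less)
      then show ?thesis
        using la by (auto simp: is_partition_def sorted_wrt_append no_zero sum_list_replicate)
    qed }
qed

theorem theorem2p7:
  fixes l k :: nat
  assumes "k \<ge> 2" and "l \<ge> 1"
  shows "(\<forall>la. is_partition la l \<and> length la = k \<longrightarrow>
            card {ps \<in> admissible_seqs l k. seq_type l k ps = la} = (num_SYT la)\<^sup>2) \<and>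
         card (admissible_seqs l k) =
           (\<Sum>la | is_partition la l \<and> 0 \<notin> set la \<and> ht la \<le> k. (num_SYT la)\<^sup>2)"
proof
  show "\<forall>la. is_partition la l \<and> length la = k \<longrightarrow>
            card {ps \<in> admissible_seqs l k. seq_type l k ps = la} = (num_SYT la)\<^sup>2"
    using card_admissible_of_type(2)[OF assms(1)] by blast
  let ?L = "{la. is_partition la l \<and> length la = k}"
  have "admissible_seqs l k = (\<Union>la\<in>?L. {ps \<in> admissible_seqs l k. seq_type l k ps = la})"
    using seq_type_is_partition[OF assms(1)] by auto
  then have "card (admissible_seqs l k) =
      card (\<Union>la\<in>?L. {ps \<in> admissible_seqs l k. seq_type l k ps = la})" by simp
  also have "\<dots> = (\<Sum>la\<in>?L. card {ps \<in> admissible_seqs l k. seq_type l k ps = la})"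
    by (rule card_UN_disjoint) (auto simp: finite_partitions_of_length card_admissible_of_type(1)[OF assms(1)])
  also have "\<dots> = (\<Sum>la\<in>?L. (num_SYT la)\<^sup>2)"
    by (rule sum.cong) (auto simp: card_admissible_of_type(2)[OF assms(1)])
  also have "\<dots> = (\<Sum>la | is_partition la l \<and> 0 \<notin> set la \<and> ht la \<le> k. (num_SYT la)\<^sup>2)"
    by (rule sum_num_SYT_without_zeros)
  finally show "card (admissible_seqs l k) =
      (\<Sum>la | is_partition la l \<and> 0 \<notin> set la \<and> ht la \<le> k. (num_SYT la)\<^sup>2)" .
qed

end
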